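(* Let $B$ be the ordinal sum of copulas $\{B_k\mid k=1,\ldots,n\}$ with respect to a finite family $\{(a_k,b_k)\mid k=1,\ldots,n\}$ of disjoint open subintervals of $[0,1]$. If $\tfrac12$ does not belong to any of the subintervals $(a_k,b_k)$, then $$\gamma(B)=1-\tfrac23\sum_{k=1}^n(b_k-a_k)^2(1-\phi(B_k)).$$ If $\tfrac12\in(a_j,b_j)$ for some $j\in\{1,\ldots,n\}$, then $$\gamma(B)=4(b_j-a_j)^2\max\{0,c\}^2+4a_j-4a_j^2-\tfrac23\sum_{k=1}^n(b_k-a_k)^2(1-\phi(B_k))+4(b_j-a_j)^2\int_{\max\{0,c\}}^{1+\min\{0,c\}}B_j(t,1+c-t)\,dt,$$ where $c=\frac{1-a_j-b_j}{b_j-a_j}\in(-1,1)$. In particular, if $a_j+b_j=1$ for some $j\in\{1,\ldots,n\}$ (i.e., $\tfrac12$ is the midpoint of $(a_j,b_j)$), then $$\gamma(B)=1-(b_j-a_j)^2(1-\gamma(B_j))-\tfrac23\sum_{\substack{k=1\\k\ne j}}^n(b_k-a_k)^2(1-\phi(B_k)).$$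
   Context: Let $\mathbb{I}=[0,1]$. A (bivariate) copula is a function $C:\mathbb{I}^2\to\mathbb{I}$ with $C(0,v)=C(u,0)=0$, $C(u,1)=u$, $C(1,v)=v$ for all $u,v\in\mathbb{I}$, and $C(u_2,v_2)-C(u_2,v_1)-C(u_1,v_2)+C(u_1,v_1)\ge 0$ whenever $u_1\le u_2$, $v_1\le v_2$ in $\mathbb{I}$. Given disjoint open subintervals $(a_k,b_k)$ of $\mathbb{I}$ and copulas $B_k$, $k=1,\ldots,n$, the ordinal sum $B$ of $\{B_k\}$ with respect to $\{(a_k,b_k)\}$ is the copula defined by $B(u,v)=a_k+(b_k-a_k)B_k\big(\frac{u-a_k}{b_k-a_k},\frac{v-a_k}{b_k-a_k}\big)$ if $(u,v)\in[a_k,b_k]^2$ for some $k$, and $B(u,v)=\min\{u,v\}$ otherwise. For a copula $C$, Gini's gamma is $\gamma(C)=4\int_0^1 C(u,u)\,du+4\int_0^1 C(u,1-u)\,du-2$ and Spearman's footrule is $\phi(C)=6\int_0^1 C(u,u)\,du-2$. *)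

theory Defs
  imports "HOL-Analysis.Analysis"
begin

text \<open>A copula is a function on the unit square; it is represented by a total function on pairs of
  reals, constrained only on the unit square.\<close>

definition copula :: "(real \<Rightarrow> real \<Rightarrow> real) \<Rightarrow> bool" where
  "copula C \<longleftrightarrow>
     (\<forall>u\<in>{0..1}. \<forall>v\<in>{0..1}. C u v \<in> {0..1}) \<and>
     (\<forall>v\<in>{0..1}. C 0 v = 0) \<and>
     (\<forall>u\<in>{0..1}. C u 0 = 0) \<and>
     (\<forall>u\<in>{0..1}. C u 1 = u) \<and>
     (\<forall>v\<in>{0..1}. C 1 v = v) \<and>
     (\<forall>u1\<in>{0..1}. \<forall>u2\<in>{0..1}. \<forall>v1\<in>{0..1}. \<forall>v2\<in>{0..1}.
        u1 \<le> u2 \<longrightarrow> v1 \<le> v2 \<longrightarrow> C u2 v2 - C u2 v1 - C u1 v2 + C u1 v1 \<ge> 0)"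

text \<open>Two of the closed squares may share a corner. There both indices give the same value, so
  the choice of \<open>k\<close> below is immaterial; see \<open>ordinal_sum_eq\<close>.\<close>

definition ordinal_sum ::
  "'i set \<Rightarrow> ('i \<Rightarrow> real) \<Rightarrow> ('i \<Rightarrow> real) \<Rightarrow> ('i \<Rightarrow> real \<Rightarrow> real \<Rightarrow> real) \<Rightarrow> real \<Rightarrow> real \<Rightarrow> real" where
  "ordinal_sum K a b B u v =
     (if \<exists>k\<in>K. u \<in> {a k..b k} \<and> v \<in> {a k..b k}
      then let k = (SOME k. k \<in> K \<and> u \<in> {a k..b k} \<and> v \<in> {a k..b k})
           in a k + (b k - a k) * B k ((u - a k) / (b k - a k)) ((v - a k) / (b k - a k))
      else min u v)"

definition gini_gamma :: "(real \<Rightarrow> real \<Rightarrow> real) \<Rightarrow> real" where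
  "gini_gamma C =
     4 * integral {0..1} (\<lambda>u. C u u) + 4 * integral {0..1} (\<lambda>u. C u (1 - u)) - 2"

definition spearman_footrule :: "(real \<Rightarrow> real \<Rightarrow> real) \<Rightarrow> real" where
  "spearman_footrule C = 6 * integral {0..1} (\<lambda>u. C u u) - 2"

lemma ordinal_sum_eq:
  assumes less: "\<And>k. k \<in> K \<Longrightarrow> a k < b k"
    and disj: "disjoint_family_on (\<lambda>k. {a k<..<b k}) K"
    and cop: "\<And>k. k \<in> K \<Longrightarrow> copula (B k)"
    and k: "k \<in> K" "u \<in> {a k..b k}" "v \<in> {a k..b k}"
  shows "ordinal_sum K a b B u v =
    a k + (b k - a k) * B k ((u - a k) / (b k - a k)) ((v - a k) / (b k - a k))"
proof -
  define l where "l = (SOME k. k \<in> K \<and> u \<in> {a k..b k} \<and> v \<in> {a k..b k})"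
  have l: "l \<in> K" "u \<in> {a l..b l}" "v \<in> {a l..b l}"
    using someI[of "\<lambda>k. k \<in> K \<and> u \<in> {a k..b k} \<and> v \<in> {a k..b k}" k] k
    unfolding l_def by blast+
  have *: "ordinal_sum K a b B u v =
    a l + (b l - a l) * B l ((u - a l) / (b l - a l)) ((v - a l) / (b l - a l))"
    using k unfolding ordinal_sum_def l_def Let_def by auto
  have corner: "B i 0 0 = 0" "B i 1 1 = 1" if "i \<in> K" for i
    using cop[OF that] by (auto simp: copula_def)
  show ?thesis
  proof (cases "l = k")
    case False
    have "b k \<le> a l \<or> b l \<le> a k"
    proof (rule ccontr)
      assume "\<not> ?thesis"
      then have "max (a k) (a l) < min (b k) (b l)"
        using less[OF k(1)] less[OF l(1)] by auto
      then obtain x where "max (a k) (a l) < x" "x < min (b k) (b l)"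
        using dense by blast
      then have "x \<in> {a k<..<b k} \<inter> {a l<..<b l}" by auto
      then show False
        using disj k(1) l(1) False unfolding disjoint_family_on_def by blast
    qed
    then show ?thesis
    proof
      assume "b k \<le> a l"
      then have "u = b k" "v = b k" "a l = b k" using k l by auto
      then show ?thesis
        unfolding * using less[OF k(1)] corner k(1) l(1) by simp
    next
      assume "b l \<le> a k"
      then have "u = b l" "v = b l" "a k = b l" using k l by auto
      then show ?thesis
        unfolding * using less[OF l(1)] corner k(1) l(1) by simp
    qed
  qed (use * in simp)
qed

end

theory Submission
  imports Defs
begin

text \<open>
  Along the diagonal, the ordinal sum is the identity plus one bump for each interval \<open>[a\<^sub>k, b\<^sub>k]\<close>.
  The bumps vanish at the endpoints, so they simply add up, and rescaling \<open>[a\<^sub>k, b\<^sub>k]\<close> to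
  \<open>[0, 1]\<close> turns each of their integrals into a footrule. A point \<open>(u, 1 - u)\<close> of the
  antidiagonal lies in \<open>[a\<^sub>k, b\<^sub>k]\<^sup>2\<close> only if \<open>1/2 \<in> [a\<^sub>k, b\<^sub>k]\<close>. If \<open>1/2\<close> is an
  endpoint, this happens only at \<open>u = 1/2\<close>, where the ordinal sum still equals \<open>min u (1 - u)\<close>.
  So only a block \<open>j\<close> with \<open>1/2\<close> in its interior modifies \<open>min u (1 - u)\<close>, on the interval
  \<open>[m, 1 - m]\<close> with \<open>m = max a\<^sub>j (1 - b\<^sub>j)\<close>.
\<close>

section \<open>Lipschitz continuity of copulas\<close>

lemma copula_cond:
  assumes "copula C"
  shows "v \<in> {0..1} \<Longrightarrow> C 0 v = 0" "u \<in> {0..1} \<Longrightarrow> C u 0 = 0"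
    "u \<in> {0..1} \<Longrightarrow> C u 1 = u" "v \<in> {0..1} \<Longrightarrow> C 1 v = v"
    "\<lbrakk>0 \<le> u1; u1 \<le> u2; u2 \<le> 1; 0 \<le> v1; v1 \<le> v2; v2 \<le> 1\<rbrakk>
      \<Longrightarrow> C u2 v2 - C u2 v1 - C u1 v2 + C u1 v1 \<ge> 0"
  using assms by (auto simp: copula_def)

text \<open>Monotonicity comes from the nonnegative volume of \<open>[u1, u2] x [0, v]\<close>, the
  upper bound from that of \<open>[u1, u2] x [v, 1]\<close>; the boundary conditions evaluate the
  other two corners.\<close>

lemma copula_increment_fst:
  assumes C: "copula C" and "0 \<le> u1" "u1 \<le> u2" "u2 \<le> 1" "0 \<le> v" "v \<le> 1"
  shows "0 \<le> C u2 v - C u1 v" "C u2 v - C u1 v \<le> u2 - u1"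
  using copula_cond(5)[OF C, of u1 u2 0 v] copula_cond(5)[OF C, of u1 u2 v 1]
    copula_cond(2,3)[OF C, of u1] copula_cond(2,3)[OF C, of u2] assms
  by auto

lemma copula_increment_snd:
  assumes C: "copula C" and "0 \<le> v1" "v1 \<le> v2" "v2 \<le> 1" "0 \<le> u" "u \<le> 1"
  shows "0 \<le> C u v2 - C u v1" "C u v2 - C u v1 \<le> v2 - v1"
  using copula_cond(5)[OF C, of 0 u v1 v2] copula_cond(5)[OF C, of u 1 v1 v2]
    copula_cond(1,4)[OF C, of v1] copula_cond(1,4)[OF C, of v2] assms
  by auto

lemma copula_lipschitz:
  assumes C: "copula C" and "u \<in> {0..1}" "u' \<in> {0..1}" "v \<in> {0..1}" "v' \<in> {0..1}"
  shows "\<bar>C u v - C u' v'\<bar> \<le> \<bar>u - u'\<bar> + \<bar>v - v'\<bar>"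
proof -
  have "\<bar>C u v - C u' v\<bar> \<le> \<bar>u - u'\<bar>"
    using copula_increment_fst[OF C, of u u' v] copula_increment_fst[OF C, of u' u v] assms
    by (cases "u \<le> u'") auto
  moreover have "\<bar>C u' v - C u' v'\<bar> \<le> \<bar>v - v'\<bar>"
    using copula_increment_snd[OF C, of v v' u'] copula_increment_snd[OF C, of v' v u'] assms
    by (cases "v \<le> v'") auto
  ultimately show ?thesis by linarith
qed

text \<open>The Lipschitz bound squeezes the increment to 0. This makes the sections
  \<open>B k t t\<close> and \<open>B j t (1 + c - t)\<close> integrable.\<close>

lemma continuous_on_copula:
  fixes f g :: "'a::topological_space \<Rightarrow> real"
  assumes C: "copula C"
    and f: "continuous_on S f" "\<And>x. x \<in> S \<Longrightarrow> f x \<in> {0..1}"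
    and g: "continuous_on S g" "\<And>x. x \<in> S \<Longrightarrow> g x \<in> {0..1}"
  shows "continuous_on S (\<lambda>x. C (f x) (g x))"
  unfolding continuous_on_def
proof
  fix x assume x: "x \<in> S"
  have "((\<lambda>y. \<bar>f y - f x\<bar> + \<bar>g y - g x\<bar>) \<longlongrightarrow> \<bar>f x - f x\<bar> + \<bar>g x - g x\<bar>) (at x within S)"
    using f(1) g(1) x by (intro tendsto_intros) (auto simp: continuous_on_def)
  then have "((\<lambda>y. \<bar>f y - f x\<bar> + \<bar>g y - g x\<bar>) \<longlongrightarrow> 0) (at x within S)" by simp
  moreover have "\<forall>\<^sub>F y in at x within S.
      norm (C (f y) (g y) - C (f x) (g x)) \<le> \<bar>f y - f x\<bar> + \<bar>g y - g x\<bar>"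
    using copula_lipschitz[OF C] f(2) g(2) x by (auto simp: eventually_at_filter)
  ultimately have "((\<lambda>y. C (f y) (g y) - C (f x) (g x)) \<longlongrightarrow> 0) (at x within S)"
    by (rule Lim_null_comparison[rotated])
  then show "((\<lambda>y. C (f y) (g y)) \<longlongrightarrow> C (f x) (g x)) (at x within S)"
    by (simp add: LIM_zero_iff)
qed

section \<open>Affine substitution and integrals along the antidiagonal\<close>

lemma has_integral_rescale:
  fixes f :: "real \<Rightarrow> real"
  assumes "f integrable_on {p..q}" and d: "0 < d"
  shows "((\<lambda>u. f ((u - a) / d)) has_integral d * integral {p..q} f) {a + d * p..a + d * q}"
proof -
  have "((\<lambda>u. f ((1 / d) *\<^sub>R u + - (a / d))) has_integral integral {p..q} f /\<^sub>R (1 / d) ^ DIM(real))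
      (cbox ((p - - (a / d)) /\<^sub>R (1 / d)) ((q - - (a / d)) /\<^sub>R (1 / d)))"
    using assms by (intro has_integral_affinity') (auto simp: has_integral_integral)
  moreover have "(x - - (a / d)) /\<^sub>R (1 / d) = a + d * x" for x
    using d by (simp add: field_simps)
  ultimately show ?thesis
    by (simp add: diff_divide_distrib mult.commute)
qed

text \<open>Each of the two outer intervals contributes a triangle of area
  \<open>m\<^sup>2 / 2\<close>. Prescribing \<open>f\<close> on their interiors is enough, since
  endpoints do not affect the integral.\<close>

lemma has_integral_min_antidiagonal:
  fixes f :: "real \<Rightarrow> real"
  assumes "0 \<le> m" "m \<le> 1 / 2"
    "\<And>u. u \<in> {0<..<m} \<union> {1 - m<..<1} \<Longrightarrow> f u = min u (1 - u)"
    "(f has_integral J) {m..1 - m}"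
  shows "(f has_integral m\<^sup>2 + J) {0..1}"
proof -
  have "((\<lambda>u. u) has_integral (m\<^sup>2 - 0\<^sup>2) / 2) {0..m}"
    using assms by (intro ident_has_integral) auto
  then have "(f has_integral (m\<^sup>2 - 0\<^sup>2) / 2) {0..m}"
    by (rule has_integral_spike_interior[where a = 0 and b = m, simplified]) (use assms in auto)
  then have l: "(f has_integral m\<^sup>2 / 2) {0..m}" by simp
  have "((\<lambda>u. 1 - u) has_integral (1 * m - (1\<^sup>2 - (1 - m)\<^sup>2) / 2)) {1 - m..1}"
    using assms has_integral_const_real[of "1::real" "1 - m" 1]
    by (intro has_integral_diff ident_has_integral) auto
  then have "(f has_integral (1 * m - (1\<^sup>2 - (1 - m)\<^sup>2) / 2)) {1 - m..1}"
    by (rule has_integral_spike_interior[where a = "1 - m" and b = 1, simplified]) (use assms in auto)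
  then have r: "(f has_integral m\<^sup>2 / 2) {1 - m..1}"
    by (simp add: power2_eq_square field_simps)
  show ?thesis
    using has_integral_combine[OF _ _ has_integral_combine[OF _ _ l assms(4)] r] assms(1,2)
    by (simp add: algebra_simps)
qed

text \<open>If \<open>u\<close> were interior to the second interval, it would have points of the
  first open interval arbitrarily close to it, so the two open intervals would meet.\<close>

lemma disjoint_intervals_common_point:
  fixes a b :: "'i \<Rightarrow> 'a::dense_linorder"
  assumes less: "a k < b k" "a l < b l"
    and disj: "{a k<..<b k} \<inter> {a l<..<b l} = {}"
    and u: "u \<in> {a k..b k}" "u \<in> {a l..b l}"
  shows "u = a l \<or> u = b l"
proof (rule ccontr)
  assume "\<not> ?thesis"
  with u less have "max (a k) (a l) < min (b k) (b l)" by auto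
  then obtain x where "max (a k) (a l) < x" "x < min (b k) (b l)" using dense by blast
  then have "x \<in> {a k<..<b k} \<inter> {a l<..<b l}" by auto
  with disj show False by blast
qed

section \<open>The diagonal of an ordinal sum\<close>

locale ordinal_sum_family =
  fixes K :: "'i set" and a b :: "'i \<Rightarrow> real" and B :: "'i \<Rightarrow> real \<Rightarrow> real \<Rightarrow> real"
  assumes fin: "finite K"
    and copulas: "\<And>k. k \<in> K \<Longrightarrow> copula (B k)"
    and intervals: "\<And>k. k \<in> K \<Longrightarrow> 0 \<le> a k \<and> a k < b k \<and> b k \<le> 1"
    and disjoint: "disjoint_family_on (\<lambda>k. {a k<..<b k}) K"
begin

lemma ordinal_sum_block:
  assumes "k \<in> K" "u \<in> {a k..b k}" "v \<in> {a k..b k}"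
  shows "ordinal_sum K a b B u v =
    a k + (b k - a k) * B k ((u - a k) / (b k - a k)) ((v - a k) / (b k - a k))"
  using ordinal_sum_eq[of K a b B k u v] intervals disjoint copulas assms by blast

lemma ordinal_sum_outside:
  assumes "\<And>k. k \<in> K \<Longrightarrow> \<not> (u \<in> {a k..b k} \<and> v \<in> {a k..b k})"
  shows "ordinal_sum K a b B u v = min u v"
  using assms unfolding ordinal_sum_def by (subst if_not_P) blast+

lemma ordinal_sum_corner:
  assumes "k \<in> K" "u = a k \<or> u = b k"
  shows "ordinal_sum K a b B u u = u"
  using ordinal_sum_block[of k u u] assms copula_cond[OF copulas, of k] intervals[of k] by auto

text \<open>A point interior to one block lies in no other closed block, so exactly one summand is
  active. An endpoint shared by two blocks is counted twice, harmlessly, because the bump is 0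
  there.\<close>

lemma ordinal_sum_diagonal:
  "ordinal_sum K a b B u u =
    u + (\<Sum>k\<in>K. if u \<in> {a k..b k} then ordinal_sum K a b B u u - u else 0)"
proof (cases "\<exists>k\<in>K. u \<in> {a k<..<b k}")
  case True
  then obtain k where k: "k \<in> K" "u \<in> {a k<..<b k}" by blast
  have "u \<notin> {a l..b l}" if "l \<in> K" "l \<noteq> k" for l
    using disjoint_intervals_common_point[of a l b k u] intervals k that disjoint
    by (auto simp: disjoint_family_on_def)
  then have "(\<Sum>l\<in>K. if u \<in> {a l..b l} then ordinal_sum K a b B u u - u else 0)
      = (\<Sum>l\<in>K. if l = k then ordinal_sum K a b B u u - u else 0)"
    using k by (intro sum.cong) auto
  then show ?thesis using fin k by simp
next
  case False
  have "ordinal_sum K a b B u u = u"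
  proof (cases "\<exists>k\<in>K. u \<in> {a k..b k}")
    case True
    with False obtain k where "k \<in> K" "u = a k \<or> u = b k" by force
    then show ?thesis by (rule ordinal_sum_corner)
  qed (use ordinal_sum_outside[of u u] in auto)
  then show ?thesis by (simp cong: if_cong)
qed

lemma has_integral_ordinal_sum_diagonal:
  "((\<lambda>u. ordinal_sum K a b B u u) has_integral
    1 / 2 - (\<Sum>k\<in>K. (b k - a k)\<^sup>2 * (1 - spearman_footrule (B k))) / 6) {0..1}"
proof -
  have "((\<lambda>u. if u \<in> {a k..b k} then ordinal_sum K a b B u u - u else 0) has_integral
      - ((b k - a k)\<^sup>2 * (1 - spearman_footrule (B k)) / 6)) {0..1}" if k: "k \<in> K" for k
  proof -
    define d where "d = b k - a k"
    have d: "d > 0" "b k = a k + d" using intervals[OF k] by (auto simp: d_def)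
    have "(\<lambda>t. B k t t) integrable_on {0..1}"
      by (intro integrable_continuous_real continuous_on_copula[OF copulas[OF k]]
          continuous_intros) auto
    note has_integral_rescale[OF this d(1), of "a k"]
    then have I: "((\<lambda>u. B k ((u - a k) / d) ((u - a k) / d)) has_integral
        d * integral {0..1} (\<lambda>t. B k t t)) {a k..b k}" using d by simp
    have "((\<lambda>u. a k + d * B k ((u - a k) / d) ((u - a k) / d) - u) has_integral
        d * a k + d * (d * integral {0..1} (\<lambda>t. B k t t)) - ((b k)\<^sup>2 - (a k)\<^sup>2) / 2) {a k..b k}"
      using d has_integral_const_real[of "a k" "a k" "b k"] ident_has_integral[of "a k" "b k"]
      by (intro has_integral_diff has_integral_add has_integral_mult_right I) auto
    \<comment> \<open>Since \<open>b k = a k + d\<close>, the left side is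
      \<open>d\<^sup>2 * (D - 1 / 2)\<close> with \<open>D\<close> the diagonal integral of
      \<open>B k\<close>, and \<open>D = (spearman_footrule (B k) + 2) / 6\<close>.\<close>
    moreover have "d * a k + d * (d * integral {0..1} (\<lambda>t. B k t t)) - ((b k)\<^sup>2 - (a k)\<^sup>2) / 2
        = - ((b k - a k)\<^sup>2 * (1 - spearman_footrule (B k)) / 6)"
      by (simp add: spearman_footrule_def d power2_eq_square field_simps)
    ultimately have "((\<lambda>u. a k + d * B k ((u - a k) / d) ((u - a k) / d) - u) has_integral
        - ((b k - a k)\<^sup>2 * (1 - spearman_footrule (B k)) / 6)) {a k..b k}"
      by (simp only:)
    then have "((\<lambda>u. ordinal_sum K a b B u u - u) has_integral
        - ((b k - a k)\<^sup>2 * (1 - spearman_footrule (B k)) / 6)) {a k..b k}"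
      by (rule has_integral_eq[rotated]) (simp add: ordinal_sum_block[OF k] d_def)
    then show ?thesis
      using intervals[OF k] by (subst has_integral_restrict) auto
  qed
  then have "((\<lambda>u. u + (\<Sum>k\<in>K. if u \<in> {a k..b k} then ordinal_sum K a b B u u - u else 0))
      has_integral (1\<^sup>2 - 0\<^sup>2) / 2
        + (\<Sum>k\<in>K. - ((b k - a k)\<^sup>2 * (1 - spearman_footrule (B k)) / 6))) {0..1}"
    by (intro has_integral_add has_integral_sum ident_has_integral fin) auto
  then show ?thesis
    unfolding ordinal_sum_diagonal[symmetric] by (simp add: sum_negf sum_divide_distrib)
qed

text \<open>Four times the diagonal integral starts with 2, which cancels the constant -2 in the
  definition of gamma. Only the antidiagonal integral remains to be found.\<close>

lemma gini_gamma_ordinal_sum: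
  assumes "((\<lambda>u. ordinal_sum K a b B u (1 - u)) has_integral A) {0..1}"
  shows "gini_gamma (ordinal_sum K a b B) =
    4 * A - 2 / 3 * (\<Sum>k\<in>K. (b k - a k)\<^sup>2 * (1 - spearman_footrule (B k)))"
  using integral_unique[OF assms] integral_unique[OF has_integral_ordinal_sum_diagonal]
  by (simp add: gini_gamma_def)

section \<open>The antidiagonal of an ordinal sum\<close>

lemma ordinal_sum_antidiagonal_outside:
  assumes "\<And>k. k \<in> K \<Longrightarrow> 1 / 2 \<in> {a k<..<b k} \<Longrightarrow> \<not> (u \<in> {a k..b k} \<and> 1 - u \<in> {a k..b k})"
  shows "ordinal_sum K a b B u (1 - u) = min u (1 - u)"
proof (cases "\<exists>k\<in>K. u \<in> {a k..b k} \<and> 1 - u \<in> {a k..b k}")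
  case True
  then obtain k where k: "k \<in> K" "u \<in> {a k..b k}" "1 - u \<in> {a k..b k}" by blast
  \<comment> \<open>The closed block contains the midpoint \<open>1 / 2\<close> of \<open>u\<close>
    and \<open>1 - u\<close>, but not in its interior. With \<open>1 / 2\<close> as an endpoint,
    \<open>u\<close> and \<open>1 - u\<close> lie on the same side of it and hence coincide.\<close>
  with assms[of k] have "a k = 1 / 2 \<or> b k = 1 / 2" by fastforce
  with k have "1 - u = u" "u = a k \<or> u = b k" by auto
  then show ?thesis using ordinal_sum_corner[OF k(1), of u] by (simp only: min.idem)
next
  case False
  then show ?thesis by (intro ordinal_sum_outside) blast
qed

lemma gini_gamma_ordinal_sum_half_notin:
  assumes "\<forall>k\<in>K. 1 / 2 \<notin> {a k<..<b k}"
  shows "gini_gamma (ordinal_sum K a b B) =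
    1 - 2 / 3 * (\<Sum>k\<in>K. (b k - a k)\<^sup>2 * (1 - spearman_footrule (B k)))"
proof -
  \<comment> \<open>Taking \<open>m = 1 / 2\<close> shrinks the middle interval to a point, whose
    integral is 0.\<close>
  have "((\<lambda>u. ordinal_sum K a b B u (1 - u)) has_integral (1 / 2)\<^sup>2 + 0) {0..1}"
    using assms ordinal_sum_antidiagonal_outside
    by (intro has_integral_min_antidiagonal) auto
  from gini_gamma_ordinal_sum[OF this] show ?thesis by (simp add: power2_eq_square)
qed

text \<open>Rescaling block \<open>j\<close> to the unit square sends the antidiagonal to the line
  of points \<open>(t, 1 + c - t)\<close>. Both coordinates lie in \<open>[0, 1]\<close> exactly for
  \<open>t\<close> between \<open>max 0 c\<close> and \<open>1 + min 0 c\<close>, which correspond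
  to \<open>u = m\<close> and \<open>u = 1 - m\<close>.\<close>

lemma gini_gamma_ordinal_sum_half_in:
  assumes j: "j \<in> K" and half: "1 / 2 \<in> {a j<..<b j}"
  defines "c \<equiv> (1 - a j - b j) / (b j - a j)"
  shows "gini_gamma (ordinal_sum K a b B) =
    4 * (b j - a j)\<^sup>2 * (max 0 c)\<^sup>2 + 4 * a j - 4 * (a j)\<^sup>2
    - 2 / 3 * (\<Sum>k\<in>K. (b k - a k)\<^sup>2 * (1 - spearman_footrule (B k)))
    + 4 * (b j - a j)\<^sup>2 * integral {max 0 c..1 + min 0 c} (\<lambda>t. B j t (1 + c - t))"
proof -
  define d where "d = b j - a j"
  define m where "m = max (a j) (1 - b j)"
  define I where "I = integral {max 0 c..1 + min 0 c} (\<lambda>t. B j t (1 + c - t))"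
  have d: "d > 0" "b j = a j + d" using half by (auto simp: d_def)
  have dc: "d * c = 1 - a j - b j" using d by (simp add: c_def)
  have m: "0 \<le> m" "m < 1 / 2" using half intervals[OF j] by (auto simp: m_def max_def)
  have "0 \<le> c \<longleftrightarrow> a j + b j \<le> 1"
    using d by (auto simp: c_def zero_le_divide_iff)
  then have ends: "a j + d * max 0 c = m" "a j + d * (1 + min 0 c) = 1 - m"
    using d dc by (auto simp: m_def max_def min_def algebra_simps)
  have arg: "(1 - u - a j) / d = 1 + c - (u - a j) / d" for u
    using d dc by (simp add: field_simps)
  have "(\<lambda>t. B j t (1 + c - t)) integrable_on {max 0 c..1 + min 0 c}"
    by (intro integrable_continuous_real continuous_on_copula[OF copulas[OF j]]
        continuous_intros) auto
  from has_integral_rescale[OF this d(1), of "a j"]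
  have "((\<lambda>u. B j ((u - a j) / d) ((1 - u - a j) / d)) has_integral d * I) {m..1 - m}"
    unfolding ends arg I_def .
  then have "((\<lambda>u. a j + d * B j ((u - a j) / d) ((1 - u - a j) / d)) has_integral
      (1 - 2 * m) * a j + d * (d * I)) {m..1 - m}"
    using m has_integral_const_real[of "a j" m "1 - m"]
    by (intro has_integral_add has_integral_mult_right) auto
  then have "((\<lambda>u. ordinal_sum K a b B u (1 - u)) has_integral
      (1 - 2 * m) * a j + d * (d * I)) {m..1 - m}"
    by (rule has_integral_eq[rotated])
      (use j in \<open>auto simp: d_def m_def intro!: ordinal_sum_block[symmetric]\<close>)
  moreover have "ordinal_sum K a b B u (1 - u) = min u (1 - u)"
    if u: "u \<in> {0<..<m} \<union> {1 - m<..<1}" for u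
  proof (rule ordinal_sum_antidiagonal_outside)
    fix k assume k: "k \<in> K" "1 / 2 \<in> {a k<..<b k}"
    with j half disjoint have "k = j" unfolding disjoint_family_on_def by blast
    then show "\<not> (u \<in> {a k..b k} \<and> 1 - u \<in> {a k..b k})"
      using u m by (auto simp: m_def)
  qed
  ultimately have "((\<lambda>u. ordinal_sum K a b B u (1 - u)) has_integral
      m\<^sup>2 + ((1 - 2 * m) * a j + d * (d * I))) {0..1}"
    using m by (intro has_integral_min_antidiagonal) auto
  note * = gini_gamma_ordinal_sum[OF this]
  have "m = a j + d * max 0 c" using ends by simp
  moreover have "d * max 0 c = 0 \<or> d * max 0 c = 1 - a j - b j"
    using dc by (auto simp: max_def)
  \<comment> \<open>Completing the square: the left side is
    \<open>(m - a j)\<^sup>2 + a j - (a j)\<^sup>2\<close>.\<close>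
  ultimately have "m\<^sup>2 + (1 - 2 * m) * a j = (d * max 0 c)\<^sup>2 + a j - (a j)\<^sup>2"
    by (simp add: power2_eq_square algebra_simps)
  then show ?thesis
    unfolding * by (simp add: power2_eq_square algebra_simps flip: d_def I_def)
qed

end

theorem proposition3p5:
  fixes n :: nat
    and a b :: "nat \<Rightarrow> real"
    and B :: "nat \<Rightarrow> real \<Rightarrow> real \<Rightarrow> real"
  assumes copulas: "\<And>k. k \<in> {1..n} \<Longrightarrow> copula (B k)"
    and intervals: "\<And>k. k \<in> {1..n} \<Longrightarrow> 0 \<le> a k \<and> a k < b k \<and> b k \<le> 1"
    and disjoint: "disjoint_family_on (\<lambda>k. {a k<..<b k}) {1..n}"
  shows
    "((\<forall>k\<in>{1..n}. 1/2 \<notin> {a k<..<b k}) \<longrightarrow>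
        gini_gamma (ordinal_sum {1..n} a b B) =
          1 - 2/3 * (\<Sum>k=1..n. (b k - a k)^2 * (1 - spearman_footrule (B k)))) \<and>
     (\<forall>j\<in>{1..n}. 1/2 \<in> {a j<..<b j} \<longrightarrow>
        (let c = (1 - a j - b j) / (b j - a j) in
          c \<in> {-1<..<1} \<and>
          gini_gamma (ordinal_sum {1..n} a b B) =
            4 * (b j - a j)^2 * (max 0 c)^2 + 4 * a j - 4 * (a j)^2
            - 2/3 * (\<Sum>k=1..n. (b k - a k)^2 * (1 - spearman_footrule (B k)))
            + 4 * (b j - a j)^2 * integral {max 0 c..1 + min 0 c} (\<lambda>t. B j t (1 + c - t)))) \<and>
     (\<forall>j\<in>{1..n}. a j + b j = 1 \<longrightarrow>
        gini_gamma (ordinal_sum {1..n} a b B) =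
          1 - (b j - a j)^2 * (1 - gini_gamma (B j))
          - 2/3 * (\<Sum>k\<in>{1..n} - {j}. (b k - a k)^2 * (1 - spearman_footrule (B k))))"
proof -
  interpret ordinal_sum_family "{1..n}" a b B
    using assms by unfold_locales auto
  show ?thesis
  proof (intro conjI impI ballI)
    assume "\<forall>k\<in>{1..n}. 1/2 \<notin> {a k<..<b k}"
    then show "gini_gamma (ordinal_sum {1..n} a b B) =
        1 - 2/3 * (\<Sum>k=1..n. (b k - a k)^2 * (1 - spearman_footrule (B k)))"
      by (rule gini_gamma_ordinal_sum_half_notin)
  next
    fix j assume j: "j \<in> {1..n}" and half: "1/2 \<in> {a j<..<b j}"
    \<comment> \<open>The upper bound amounts to \<open>1/2 < b j\<close>, the lower one to
      \<open>a j < 1/2\<close>.\<close>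
    have "(1 - a j - b j) / (b j - a j) \<in> {-1<..<1}"
      using half by (auto simp: field_simps)
    with gini_gamma_ordinal_sum_half_in[OF j half]
    show "let c = (1 - a j - b j) / (b j - a j) in
        c \<in> {-1<..<1} \<and>
        gini_gamma (ordinal_sum {1..n} a b B) =
          4 * (b j - a j)^2 * (max 0 c)^2 + 4 * a j - 4 * (a j)^2
          - 2/3 * (\<Sum>k=1..n. (b k - a k)^2 * (1 - spearman_footrule (B k)))
          + 4 * (b j - a j)^2 * integral {max 0 c..1 + min 0 c} (\<lambda>t. B j t (1 + c - t))"
      by (simp only: Let_def simp_thms)
  next
    fix j assume j: "j \<in> {1..n}" and mid: "a j + b j = 1"
    have half: "1/2 \<in> {a j<..<b j}" and b: "b j = 1 - a j" using intervals[OF j] mid by auto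
    show "gini_gamma (ordinal_sum {1..n} a b B) =
        1 - (b j - a j)^2 * (1 - gini_gamma (B j))
        - 2/3 * (\<Sum>k\<in>{1..n} - {j}. (b k - a k)^2 * (1 - spearman_footrule (B k)))"
      \<comment> \<open>Here \<open>c = 0\<close>, so the remaining integral is the antidiagonal one
        of \<open>B j\<close>. The summand \<open>j\<close> split off from the sum supplies the
        diagonal integral of \<open>gini_gamma (B j)\<close>, and
        \<open>4 * a j - 4 * (a j)^2 = 1 - (b j - a j)^2\<close>.\<close>
      using gini_gamma_ordinal_sum_half_in[OF j half]
      unfolding sum.remove[OF finite_atLeastAtMost j]
      by (simp add: b gini_gamma_def spearman_footrule_def power2_eq_square algebra_simps)
  qed
qed

end
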